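(* Let $r \geq 2$ be an integer and let $m:\mathbb{N}\to[0,\infty)$ be any function with $m(n) = o(n^{\frac{r+1}{r}})$ as $n\to\infty$. Then there is a function $h:\mathbb{N}\to[0,\infty)$ with $h(n)=o(n)$ such that every $(r+1)$-saturated graph $G$ on $n$ vertices with $e(G) \geq t_r(n) - m(n)$ contains an (induced) complete $r$-partite subgraph on at least $n - h(n)$ vertices. In words: every $(r+1)$-saturated graph on $n$ vertices with $t_r(n) - o(n^{\frac{r+1}{r}})$ edges contains a complete $r$-partite subgraph on $(1-o(1))n$ vertices.
   Context: All graphs are finite and simple. For an integer $r\ge 2$, a graph $G$ is $(r+1)$-saturated (maximal $K_{r+1}$-free) if it contains no copy of $K_{r+1}$ but adding any edge of its complement creates a copy of $K_{r+1}$. $T_r(n)$ denotes the $r$-partite Turán graph: the complete $r$-partite graph on $n$ vertices whose $r$ classes each have $\lfloor n/r\rfloor$ or $\lceil n/r\rceil$ vertices, and $t_r(n)=e(T_r(n))$. Whenever an $r$-partite subgraph is spoken of, it is required to be induced; i.e. a complete $r$-partite subgraph on vertex set $U$ means that $G[U]$ is complete $r$-partite. *)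

theory Defs
  imports Complex_Main "HOL-Library.Landau_Symbols"
begin

text \<open>
  A graph is given by its vertex set and its edge set, the edges being two-element sets of vertices.
\<close>

definition simple_graph :: "'a set \<Rightarrow> 'a set set \<Rightarrow> bool" where
  "simple_graph V E \<longleftrightarrow> finite V \<and> (\<forall>e\<in>E. e \<subseteq> V \<and> card e = 2)"

definition contains_clique :: "nat \<Rightarrow> 'a set \<Rightarrow> 'a set set \<Rightarrow> bool" where
  "contains_clique k V E \<longleftrightarrow>
     (\<exists>K\<subseteq>V. card K = k \<and> (\<forall>x\<in>K. \<forall>y\<in>K. x \<noteq> y \<longrightarrow> {x, y} \<in> E))"

definition saturated :: "nat \<Rightarrow> 'a set \<Rightarrow> 'a set set \<Rightarrow> bool" where
  "saturated k V E \<longleftrightarrow>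
     \<not> contains_clique k V E \<and>
     (\<forall>x\<in>V. \<forall>y\<in>V. x \<noteq> y \<and> {x, y} \<notin> E \<longrightarrow> contains_clique k V (insert {x, y} E))"

definition induced_edges :: "'a set \<Rightarrow> 'a set set \<Rightarrow> 'a set set" where
  "induced_edges U E = {e \<in> E. e \<subseteq> U}"

text \<open>
  The classes of a multipartite graph on \<open>U\<close> are the fibres on \<open>U\<close> of a map \<open>c\<close> into the class indices.
\<close>

definition multipartite_edges :: "('a \<Rightarrow> nat) \<Rightarrow> 'a set \<Rightarrow> 'a set set" where
  "multipartite_edges c U = {{x, y} | x y. x \<in> U \<and> y \<in> U \<and> c x \<noteq> c y}"

text \<open>
  Classes may be empty: this is needed for the Turan graph on fewer than \<open>r\<close> vertices to be
  complete \<open>r\<close>-partite.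
\<close>

definition complete_multipartite :: "nat \<Rightarrow> 'a set \<Rightarrow> 'a set set \<Rightarrow> bool" where
  "complete_multipartite r U F \<longleftrightarrow>
     (\<exists>c. (\<forall>x\<in>U. c x < r) \<and> F = multipartite_edges c U)"

text \<open>
  The Turan graph on the vertices \<open>0, \<dots>, n - 1\<close>, whose classes are the residue classes modulo \<open>r\<close>.
  That these are balanced is \<open>card_turan_class\<close> below.
\<close>

definition turan_edges :: "nat \<Rightarrow> nat \<Rightarrow> nat set set" where
  "turan_edges r n = multipartite_edges (\<lambda>v. v mod r) {..<n}"

definition turan_size :: "nat \<Rightarrow> nat \<Rightarrow> nat" where
  "turan_size r n = card (turan_edges r n)"

lemma complete_multipartite_turan:
  "r > 0 \<Longrightarrow> complete_multipartite r {..<n} (turan_edges r n)"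
  unfolding complete_multipartite_def turan_edges_def
  by (intro exI[of _ "\<lambda>v. v mod r"]) simp

lemma card_residue_class:
  fixes r n i :: nat
  assumes "i < r"
  shows "card {v \<in> {..<n}. v mod r = i} = (n + (r - 1 - i)) div r"
proof (induction n)
  case 0
  then show ?case using assms by simp
next
  case (Suc n)
  have *: "Suc (n + (r - 1 - i)) mod r = 0 \<longleftrightarrow> n mod r = i"
  proof -
    have "Suc (n + (r - 1 - i)) mod r = (n mod r + (r - i)) mod r"
    proof -
      have "Suc (n + (r - 1 - i)) = n + (r - i)" using assms by simp
      then show ?thesis by (simp only: mod_add_left_eq)
    qed
    also have "\<dots> = 0 \<longleftrightarrow> n mod r = i"
    proof -
      have s: "n mod r < r" using assms by simp
      consider "n mod r < i" | "n mod r = i" | "n mod r > i" by linarith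
      then show ?thesis
      proof cases
        case 3
        then have "n mod r + (r - i) = (n mod r - i) + r" using assms by simp
        then have "(n mod r + (r - i)) mod r = n mod r - i"
          using s by (simp only: mod_add_self2) (simp add: less_imp_diff_less)
        then show ?thesis using 3 by linarith
      qed (use assms in auto)
    qed
    finally show ?thesis .
  qed
  have "{v \<in> {..<Suc n}. v mod r = i} =
      (if n mod r = i then insert n {v \<in> {..<n}. v mod r = i} else {v \<in> {..<n}. v mod r = i})"
    by (auto simp: less_Suc_eq)
  then show ?case using Suc * by (simp add: div_Suc)
qed

lemma card_turan_class:
  fixes r n i :: nat
  assumes "i < r"
  shows "int (card {v \<in> {..<n}. v mod r = i}) \<in> {\<lfloor>real n / real r\<rfloor>, \<lceil>real n / real r\<rceil>}"
proof -
  define q s where "q = n div r" and "s = n mod r"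
  have n: "n = q * r + s" and s: "s < r" using assms by (simp_all add: q_def s_def)
  have card: "card {v \<in> {..<n}. v mod r = i} = q + (s + (r - 1 - i)) div r"
  proof -
    have "n + (r - 1 - i) = (s + (r - 1 - i)) + q * r" by (simp add: n)
    then have "(n + (r - 1 - i)) div r = q + (s + (r - 1 - i)) div r"
      using assms by (simp only: div_mult_self1)
    then show ?thesis by (simp only: card_residue_class[OF assms])
  qed
  have "real n / real r = real q + real s / real r"
    using assms by (simp add: n field_simps)
  moreover have "0 \<le> real s / real r" "real s / real r < 1" using s by auto
  ultimately have fl: "\<lfloor>real n / real r\<rfloor> = int q"
    and ce: "s > 0 \<Longrightarrow> \<lceil>real n / real r\<rceil> = int q + 1"
    using s by (auto simp: floor_eq_iff ceiling_eq_iff)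
  show ?thesis
  proof (cases "s \<le> i")
    case True
    then have "(s + (r - 1 - i)) div r = 0" using assms by simp
    then show ?thesis unfolding card fl by simp
  next
    case False
    then have "s + (r - 1 - i) = r + (s - 1 - i)" using assms by simp
    moreover have "(r + (s - 1 - i)) div r = 1"
      using s by (intro div_nat_eqI) auto
    ultimately have "(s + (r - 1 - i)) div r = 1" by simp
    then show ?thesis using False unfolding card by (simp add: ce)
  qed
qed

end

theory Submission
  imports Defs
begin

text \<open>
  Furedi's symmetrization argument yields an \<open>r\<close>-partition in which only \<open>O(m)\<close> cross pairs are missing.
  Call a vertex bad if it misses a fixed proportion of the cross pairs; there are only
  \<open>O(m/n) = o(n\<^bsup>1/r\<^esup>)\<close> bad vertices, and an edge inside a class between two good vertices would extend
  greedily to a \<open>K\<^bsub>r+1\<^esub>\<close>. It remains to cover the nonadjacent good cross pairs by \<open>o(n)\<close> vertices, for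
  which it suffices to bound a maximal matching \<open>P\<close> of such pairs between two classes. By saturation
  every \<open>p \<in> P\<close> has an \<open>(r-1)\<close>-clique \<open>K p\<close> joined to both ends.

  Branch on a common part \<open>T \<subseteq> K p\<close>. If the sets \<open>K p - T\<close> contain \<open>q\<close> pairwise disjoint ones free of bad
  vertices, the ends of the matching miss many cross pairs. Otherwise every \<open>K p - T\<close> meets a set of at
  most \<open>|Bad| + (r-1)q\<close> vertices, one of which is added to \<open>T\<close>. After \<open>r - 1\<close> rounds \<open>T = K p\<close> is a clique
  over all remaining pairs, whose ends are then completely nonadjacent. With \<open>q\<close> of order \<open>\<delta>n\<^bsup>1/r\<^esup>\<close> there
  are at most \<open>O(\<delta>\<^bsup>r-1\<^esup>n\<^bsup>(r-1)/r\<^esup>)\<close> branches, so \<open>\<epsilon>n\<close> matched pairs would force more missing pairs than there are.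
\<close>

subsection \<open>Turan numbers and Furedi stability\<close>

text \<open>Everything below is counted in ordered pairs, so that sums over vertices can be compared
  without halving.\<close>

lemma card_ordered_pairs:
  assumes "finite V" "\<forall>e\<in>E. e \<subseteq> V \<and> card e = 2"
  shows "card {(x, y) \<in> V \<times> V. {x, y} \<in> E} = 2 * card E"
proof -
  have finE: "finite E"
    using assms by (intro finite_subset[of E "Pow V"]) auto
  have eq: "{(x, y) \<in> V \<times> V. {x, y} \<in> E} = (\<Union>e\<in>E. {(x, y). {x, y} = e})"
    using assms by auto
  have two: "card e = 2" if "e \<in> E" for e using assms that by blast
  have fib: "finite {(x, y). {x, y} = e} \<and> card {(x, y). {x, y} = e} = 2" if "e \<in> E" for e
  proof -
    obtain a b where ab: "e = {a, b}" "a \<noteq> b"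
      using two[OF \<open>e \<in> E\<close>] unfolding card_2_iff by metis
    have "{(x, y). {x, y} = e} = {(a, b), (b, a)}"
    proof (rule set_eqI)
      fix z show "z \<in> {(x, y). {x, y} = e} \<longleftrightarrow> z \<in> {(a, b), (b, a)}"
        unfolding ab(1) by (cases z) (simp add: doubleton_eq_iff)
    qed
    then show ?thesis using ab(2) by simp
  qed
  have "card (\<Union>e\<in>E. {(x, y). {x, y} = e}) = (\<Sum>e\<in>E. card {(x, y). {x, y} = e})"
    using finE fib by (intro card_UN_disjoint) auto
  also have "\<dots> = 2 * card E" using fib by simp
  finally show ?thesis unfolding eq .
qed

lemma card_multipartite_edges:
  assumes "finite V"
  shows "card {(x, y) \<in> V \<times> V. c x \<noteq> c y} = 2 * card (multipartite_edges c V)"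
proof -
  have "{(x, y) \<in> V \<times> V. c x \<noteq> c y} = {(x, y) \<in> V \<times> V. {x, y} \<in> multipartite_edges c V}"
    by (auto simp: multipartite_edges_def doubleton_eq_iff)
  moreover have "\<forall>e\<in>multipartite_edges c V. e \<subseteq> V \<and> card e = 2"
  proof
    fix e assume "e \<in> multipartite_edges c V"
    then obtain x y where xy: "e = {x, y}" "x \<in> V" "y \<in> V" "c x \<noteq> c y"
      by (auto simp: multipartite_edges_def)
    then have "x \<noteq> y" by auto
    with xy show "e \<subseteq> V \<and> card e = 2" by simp
  qed
  ultimately show ?thesis using card_ordered_pairs[OF assms, of "multipartite_edges c V"] by simp
qed

lemma card_eq_sum_classes:
  fixes c :: "'a \<Rightarrow> nat"
  assumes "finite V" "\<forall>v\<in>V. c v < r"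
  shows "card V = (\<Sum>i<r. card {v \<in> V. c v = i})"
proof -
  have "(\<Sum>i<r. card {v \<in> V. c v = i}) = card (\<Union>i<r. {v \<in> V. c v = i})"
    using assms by (intro card_UN_disjoint[symmetric]) auto
  also have "(\<Union>i<r. {v \<in> V. c v = i}) = V" using assms by auto
  finally show ?thesis by simp
qed

text \<open>Ordered pairs either cross the partition or lie inside a class. Hence comparing edge
  numbers means comparing sums of squares of class sizes.\<close>

lemma card_multipartite_edges_sum_squares:
  fixes c :: "'a \<Rightarrow> nat"
  assumes "finite V" "\<forall>v\<in>V. c v < r"
  shows "2 * card (multipartite_edges c V) + (\<Sum>i<r. (card {v \<in> V. c v = i})\<^sup>2) = (card V)\<^sup>2"
proof -
  have same: "card {(x, y) \<in> V \<times> V. c x = c y} = (\<Sum>i<r. (card {v \<in> V. c v = i})\<^sup>2)"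
  proof -
    have "{(x, y) \<in> V \<times> V. c x = c y} = (\<Union>i<r. {v \<in> V. c v = i} \<times> {v \<in> V. c v = i})"
      using assms by auto
    also have "card \<dots> = (\<Sum>i<r. card ({v \<in> V. c v = i} \<times> {v \<in> V. c v = i}))"
      using assms by (intro card_UN_disjoint) auto
    finally show ?thesis by (simp add: card_cartesian_product power2_eq_square)
  qed
  have "V \<times> V = {(x, y) \<in> V \<times> V. c x \<noteq> c y} \<union> {(x, y) \<in> V \<times> V. c x = c y}" by auto
  then have "card (V \<times> V) = card ({(x, y) \<in> V \<times> V. c x \<noteq> c y} \<union> {(x, y) \<in> V \<times> V. c x = c y})"
    by (rule arg_cong[where f = card])
  also have "\<dots> = card {(x, y) \<in> V \<times> V. c x \<noteq> c y} + card {(x, y) \<in> V \<times> V. c x = c y}"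
    using assms(1) by (intro card_Un_disjoint) (auto intro: finite_subset[of _ "V \<times> V"])
  finally show ?thesis
    using card_multipartite_edges[OF assms(1), of c] same
    by (simp add: card_cartesian_product power2_eq_square)
qed

lemma balanced_residue_class:
  assumes "i < r"
  shows "card {v \<in> {..<n}. v mod r = i} \<in> {n div r, n div r + 1}"
proof -
  have "n div r \<le> (n + (r - 1 - i)) div r" by (intro div_le_mono) simp
  moreover have "(n + (r - 1 - i)) div r \<le> (n + r) div r" by (intro div_le_mono) simp
  moreover have "(n + r) div r = n div r + 1" using assms by simp
  ultimately show ?thesis using card_residue_class[OF assms, of n] by auto
qed

lemma card_multipartite_edges_le_turan:
  fixes c :: "'a \<Rightarrow> nat"
  assumes V: "finite V" "\<forall>v\<in>V. c v < r" and r: "r > 0"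
  shows "card (multipartite_edges c V) \<le> turan_size r (card V)"
proof -
  define n q where "n = card V" and "q = int (n div r)"
  define a b where "a = (\<lambda>i. int (card {v \<in> V. c v = i}))"
    and "b = (\<lambda>i. int (card {v \<in> {..<n}. v mod r = i}))"
  have turan: "finite {..<n}" "\<forall>v\<in>{..<n}. v mod r < r" using r by auto
  have b: "b i = q \<or> b i = q + 1" if "i < r" for i
    using balanced_residue_class[OF that, of n] by (auto simp: b_def q_def)
  have sa: "int n = (\<Sum>i<r. a i)"
    using card_eq_sum_classes[OF V] by (simp add: n_def a_def)
  have sb: "int n = (\<Sum>i<r. b i)"
    by (simp only: b_def of_nat_sum[symmetric] card_eq_sum_classes[OF turan, symmetric] card_lessThan)
  have ea: "2 * int (card (multipartite_edges c V)) + (\<Sum>i<r. (a i)\<^sup>2) = (int n)\<^sup>2"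
    using arg_cong[OF card_multipartite_edges_sum_squares[OF V], of int] by (simp add: n_def a_def)
  have eb: "2 * int (turan_size r n) + (\<Sum>i<r. (b i)\<^sup>2) = (int n)\<^sup>2"
    using arg_cong[OF card_multipartite_edges_sum_squares[OF turan], of int]
    by (simp add: b_def turan_size_def turan_edges_def)
  \<comment> \<open>A product of two consecutive integers is never negative and vanishes at the
    balanced sizes \<open>q\<close> and \<open>q + 1\<close>, so balanced sizes minimise it term by
    term.\<close>
  have pw: "(a i - q) * (a i - q - 1) \<ge> (b i - q) * (b i - q - 1)" if "i < r" for i
  proof -
    have "(b i - q) * (b i - q - 1) = 0" using b[OF that] by auto
    moreover have "(a i - q) * (a i - q - 1) \<ge> 0"
    proof (cases "a i \<ge> q + 1")
      case False
      then show ?thesis by (intro mult_nonpos_nonpos) auto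
    qed (intro mult_nonneg_nonneg; simp)
    ultimately show ?thesis by linarith
  qed
  have "(\<Sum>i<r. (b i - q) * (b i - q - 1)) \<le> (\<Sum>i<r. (a i - q) * (a i - q - 1))"
    by (intro sum_mono pw) auto
  \<comment> \<open>Beyond the squares, this depends only on the sum of the sizes, which is
    \<open>n\<close> for both partitions.\<close>
  moreover have ex: "(\<Sum>i<r. (f i - q) * (f i - q - 1))
      = (\<Sum>i<r. (f i)\<^sup>2) - (2 * q + 1) * (\<Sum>i<r. f i) + int r * (q * (q + 1))" for f :: "nat \<Rightarrow> int"
    by (simp add: algebra_simps power2_eq_square sum.distrib sum_subtractf sum_distrib_left)
  ultimately have "(\<Sum>i<r. (b i)\<^sup>2) \<le> (\<Sum>i<r. (a i)\<^sup>2)"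
    unfolding ex using sa sb by simp
  then show ?thesis using ea eb by (simp add: n_def)
qed

text \<open>The squared deviations from \<open>n / r\<close> sum to at most \<open>r\<close> for the
  Turan classes, each of them being off by at most 1. Losing \<open>M\<close> edges raises this sum
  by at most \<open>2 * M\<close>, and a single square is at most the sum.\<close>

lemma class_size_deviation:
  fixes c :: "'a \<Rightarrow> nat"
  assumes V: "finite V" "\<forall>v\<in>V. c v < r" and l: "l < r"
    and e: "real (card (multipartite_edges c V)) \<ge> real (turan_size r (card V)) - M"
  shows "(real (card {v \<in> V. c v = l}) - real (card V) / real r)\<^sup>2 \<le> real r + 2 * M"
proof -
  define n t where "n = card V" and "t = real n / real r"
  define a b where "a = (\<lambda>i. real (card {v \<in> V. c v = i}))"
    and "b = (\<lambda>i. real (card {v \<in> {..<n}. v mod r = i}))"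
  have r: "r > 0" using l by simp
  have turan: "finite {..<n}" "\<forall>v\<in>{..<n}. v mod r < r" using r by auto
  have sa: "real n = (\<Sum>i<r. a i)"
    using card_eq_sum_classes[OF V] by (simp add: n_def a_def)
  have sb: "real n = (\<Sum>i<r. b i)"
    by (simp only: b_def of_nat_sum[symmetric] card_eq_sum_classes[OF turan, symmetric] card_lessThan)
  have ea: "2 * real (card (multipartite_edges c V)) + (\<Sum>i<r. (a i)\<^sup>2) = (real n)\<^sup>2"
    using arg_cong[OF card_multipartite_edges_sum_squares[OF V], of real] by (simp add: n_def a_def)
  have eb: "2 * real (turan_size r n) + (\<Sum>i<r. (b i)\<^sup>2) = (real n)\<^sup>2"
    using arg_cong[OF card_multipartite_edges_sum_squares[OF turan], of real]
    by (simp add: b_def turan_size_def turan_edges_def)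
  have bt: "(b i - t)\<^sup>2 \<le> 1" if "i < r" for i
  proof -
    have "n = n div r * r + n mod r" by simp
    then have "real n = real (n div r) * real r + real (n mod r)"
      by (metis of_nat_add of_nat_mult)
    then have "t = real (n div r) + real (n mod r) / real r"
      using r by (simp add: t_def field_simps)
    moreover have "0 \<le> real (n mod r) / real r" "real (n mod r) / real r \<le> 1"
      using r by (auto simp: less_imp_le)
    moreover have "b i = real (n div r) \<or> b i = real (n div r) + 1"
      using balanced_residue_class[OF that, of n] by (auto simp: b_def)
    ultimately have "\<bar>b i - t\<bar> \<le> 1" by auto
    then show ?thesis by (simp add: abs_square_le_1)
  qed
  have ex: "(\<Sum>i<r. (f i - t)\<^sup>2) = (\<Sum>i<r. (f i)\<^sup>2) - real n * t"
    if "real n = (\<Sum>i<r. f i)" for f :: "nat \<Rightarrow> real"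
  proof -
    have "(\<Sum>i<r. (f i - t)\<^sup>2) = (\<Sum>i<r. (f i)\<^sup>2) - 2 * t * (\<Sum>i<r. f i) + real r * t\<^sup>2"
      by (simp add: algebra_simps power2_eq_square sum.distrib sum_subtractf sum_distrib_left)
    also have "real r * t\<^sup>2 = real n * t" using r by (simp add: t_def power2_eq_square)
    finally show ?thesis using that by simp
  qed
  have "(a l - t)\<^sup>2 \<le> (\<Sum>i<r. (a i - t)\<^sup>2)"
    using l by (intro member_le_sum) auto
  also have "\<dots> \<le> (\<Sum>i<r. (b i - t)\<^sup>2) + 2 * M"
    using ea eb e unfolding ex[OF sa] ex[OF sb] by (simp add: n_def)
  also have "(\<Sum>i<r. (b i - t)\<^sup>2) \<le> (\<Sum>i<r. 1)" by (intro sum_mono bt) auto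
  finally show ?thesis by (simp add: a_def t_def n_def)
qed

section \<open>Stability by symmetrization\<close>

text \<open>Induction on \<open>r\<close>: the neighbourhood of a vertex of maximum degree contains
  no clique on one vertex fewer, so it inherits a partition, and all other vertices form one new
  class.\<close>

lemma furedi_stability:
  assumes "finite V" "\<And>x y. adj x y \<Longrightarrow> adj y x" "\<And>x. \<not> adj x x"
    and "\<And>K. K \<subseteq> V \<Longrightarrow> pairwise adj K \<Longrightarrow> card K \<noteq> Suc r"
  shows "\<exists>c. (\<forall>v\<in>V. c v < r) \<and>
    card {(x, y) \<in> V \<times> V. adj x y} + card {(x, y) \<in> V \<times> V. adj x y \<and> c x = c y}
      \<le> card {(x, y) \<in> V \<times> V. c x \<noteq> (c y :: nat)}"
  using assms(1,4)
proof (induction r arbitrary: V)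
  case 0
  have "V = {}"
  proof (rule ccontr)
    assume "V \<noteq> {}"
    then obtain x where "x \<in> V" by auto
    then show False using "0.prems"(2)[of "{x}"] by simp
  qed
  then show ?case by simp
next
  case (Suc r)
  show ?case
  proof (cases "V = {}")
    case True
    then show ?thesis by simp
  next
    case False
    define N where "N = (\<lambda>x. {y \<in> V. adj x y})"
    have "Max ((\<lambda>y. card (N y)) ` V) \<in> (\<lambda>y. card (N y)) ` V"
      using False Suc.prems(1) by (intro Max_in) auto
    then obtain x where x: "x \<in> V" "card (N x) = Max ((\<lambda>y. card (N y)) ` V)" by auto
    have max: "card (N y) \<le> card (N x)" if "y \<in> V" for y
      unfolding x(2) using Suc.prems(1) that by (intro Max_ge) auto
    \<comment> \<open>The vertex \<open>x\<close> itself falls into \<open>A\<close>, since it is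
      not its own neighbour.\<close>
    define B A where "B = N x" and "A = V - B"
    have fin: "finite A" "finite B" using Suc.prems(1) by (auto simp: A_def B_def N_def)
    have VAB: "V = A \<union> B" "A \<inter> B = {}" by (auto simp: A_def B_def N_def)
    have "card K \<noteq> Suc r" if K: "K \<subseteq> B" "pairwise adj K" for K
    proof
      assume cK: "card K = Suc r"
      have "x \<notin> K" using K assms(3) by (auto simp: B_def N_def)
      moreover have "finite K" using K fin finite_subset by auto
      ultimately have "card (insert x K) = Suc (Suc r)" using cK by simp
      moreover have "pairwise adj (insert x K)"
        using K assms(2) by (auto simp: pairwise_insert B_def N_def)
      moreover have "insert x K \<subseteq> V" using x K by (auto simp: B_def N_def)
      ultimately show False using Suc.prems(2) by blast
    qed
    then obtain c where c: "\<forall>v\<in>B. c v < r"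
      and le: "card {(x, y) \<in> B \<times> B. adj x y} + card {(x, y) \<in> B \<times> B. adj x y \<and> c x = c y}
        \<le> card {(x, y) \<in> B \<times> B. c x \<noteq> c y}"
      using Suc.IH[OF fin(2)] by blast
    define c' where "c' v = (if v \<in> B then c v else r)" for v
    have c'A: "c' v = r" if "v \<in> A" for v using that by (simp add: c'_def A_def)
    have c'B: "c' v = c v" "c' v \<noteq> r" "c v \<noteq> r" if "v \<in> B" for v
      using that c by (auto simp: c'_def)
    define AA AB BA where "AA = {(x, y) \<in> A \<times> A. adj x y}"
      and "AB = {(x, y) \<in> A \<times> B. adj x y}" and "BA = {(x, y) \<in> B \<times> A. adj x y}"
    have finite: "finite AA" "finite AB" "finite BA"
      by (auto simp: AA_def AB_def BA_def fin intro: finite_subset[of _ "A \<times> A"]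
          finite_subset[of _ "A \<times> B"] finite_subset[of _ "B \<times> A"])
    have BA: "card BA = card AB"
    proof -
      have "BA = prod.swap ` AB" using assms(2) by (auto simp: AB_def BA_def image_iff)
      then show ?thesis by (simp add: card_image)
    qed
    \<comment> \<open>This is the degree sum over \<open>A\<close>, where each degree is at most
      \<open>card B\<close>. It is needed twice: \<open>AA\<close> occurs once among all edges and
      once among the edges inside classes, and \<open>BA\<close> has the size of
      \<open>AB\<close>.\<close>
    have "card AA + card AB = card (AA \<union> AB)"
      using finite VAB(2) by (intro card_Un_disjoint[symmetric]) (auto simp: AA_def AB_def)
    also have "AA \<union> AB = (SIGMA y:A. N y)"
      using VAB by (auto simp: AA_def AB_def N_def)
    also have "card \<dots> = (\<Sum>y\<in>A. card (N y))"
      using fin Suc.prems(1) by (intro card_SigmaI) (auto simp: N_def)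
    also have "\<dots> \<le> (\<Sum>y\<in>A. card B)"
      by (intro sum_mono) (auto simp: B_def A_def intro: max)
    finally have deg: "card AA + card AB \<le> card A * card B" by simp
    have finBB: "finite {(x, y) \<in> B \<times> B. Q x y}" for Q
      by (rule finite_subset[of _ "B \<times> B"]) (use fin in auto)
    have "{(x, y) \<in> V \<times> V. adj x y} = {(x, y) \<in> B \<times> B. adj x y} \<union> AA \<union> AB \<union> BA"
      using VAB by (auto simp: AA_def AB_def BA_def)
    then have "card {(x, y) \<in> V \<times> V. adj x y}
        = card ({(x, y) \<in> B \<times> B. adj x y} \<union> AA \<union> AB \<union> BA)" by (rule arg_cong[where f = card])
    then have "card {(x, y) \<in> V \<times> V. adj x y}
        \<le> card {(x, y) \<in> B \<times> B. adj x y} + card AA + card AB + card BA"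
      using card_Un_le[of "{(x, y) \<in> B \<times> B. adj x y} \<union> AA \<union> AB" BA]
        card_Un_le[of "{(x, y) \<in> B \<times> B. adj x y} \<union> AA" AB]
        card_Un_le[of "{(x, y) \<in> B \<times> B. adj x y}" AA] by linarith
    moreover have "{(x, y) \<in> V \<times> V. adj x y \<and> c' x = c' y} =
        {(x, y) \<in> B \<times> B. adj x y \<and> c x = c y} \<union> AA"
      unfolding VAB(1) AA_def by (auto simp: c'A c'B c'B(3)[symmetric])
    then have "card {(x, y) \<in> V \<times> V. adj x y \<and> c' x = c' y}
        \<le> card {(x, y) \<in> B \<times> B. adj x y \<and> c x = c y} + card AA"
      by (simp only: card_Un_le)
    moreover have "card {(x, y) \<in> V \<times> V. c' x \<noteq> c' y} =
        card {(x, y) \<in> B \<times> B. c x \<noteq> c y} + 2 * (card A * card B)"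
    proof -
      have "{(x, y) \<in> V \<times> V. c' x \<noteq> c' y} = {(x, y) \<in> B \<times> B. c x \<noteq> c y} \<union> (A \<times> B \<union> B \<times> A)"
        unfolding VAB(1) by (auto simp: c'A c'B c'B(3)[symmetric])
      also have "card \<dots> = card {(x, y) \<in> B \<times> B. c x \<noteq> c y} + card (A \<times> B \<union> B \<times> A)"
        using VAB fin finBB by (intro card_Un_disjoint) auto
      also have "card (A \<times> B \<union> B \<times> A) = card (A \<times> B) + card (B \<times> A)"
        using VAB fin by (intro card_Un_disjoint) auto
      finally show ?thesis by (simp add: card_cartesian_product)
    qed
    ultimately have "card {(x, y) \<in> V \<times> V. adj x y} + card {(x, y) \<in> V \<times> V. adj x y \<and> c' x = c' y}
        \<le> card {(x, y) \<in> V \<times> V. c' x \<noteq> c' y}"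
      using le deg BA by linarith
    moreover have "\<forall>v\<in>V. c' v < Suc r" using c by (auto simp: c'_def less_Suc_eq)
    ultimately show ?thesis by blast
  qed
qed

subsection \<open>Matchings of nonadjacent pairs\<close>

text \<open>The left side is the tangent at \<open>k = 2 * l\<close>; it replaces a quadratic bound
  by a linear one of freely chosen slope.\<close>

lemma quadratic_ge_linear:
  fixes k l :: real
  shows "l * k - l\<^sup>2 \<le> k\<^sup>2 / 4"
  using zero_le_power2[of "k / 2 - l"] by (simp add: power2_eq_square algebra_simps)

text \<open>The situation once the partition and the bad vertices are fixed. Saturation enters
  later, through the cliques over nonadjacent pairs.\<close>

locale partitioned_graph =
  fixes V :: "'a set" and adj :: "'a \<Rightarrow> 'a \<Rightarrow> bool" and r :: nat
    and c :: "'a \<Rightarrow> nat" and Bad :: "'a set"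
  assumes finite_V: "finite V"
    and adj_sym: "adj x y \<Longrightarrow> adj y x"
    and adj_irrefl: "\<not> adj x x"
    and clique_free: "K \<subseteq> V \<Longrightarrow> pairwise adj K \<Longrightarrow> card K \<noteq> Suc r"
    and r_pos: "r > 0"
    and Bad_subset: "Bad \<subseteq> V"
    and good_independent: "x \<in> V - Bad \<Longrightarrow> y \<in> V - Bad \<Longrightarrow> c x = c y \<Longrightarrow> \<not> adj x y"
begin

definition missing :: "'a \<Rightarrow> nat" where
  "missing x = card {y \<in> V. c y \<noteq> c x \<and> \<not> adj x y}"

definition clique_over :: "'a \<times> 'a \<Rightarrow> 'a set \<Rightarrow> bool" where
  "clique_over p K \<longleftrightarrow> K \<subseteq> V \<and> card K = r - 1 \<and> pairwise adj K \<and>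
     (\<forall>z\<in>K. adj (fst p) z \<and> adj (snd p) z)"

text \<open>For \<open>i \<noteq> j\<close> the two ends lie in different classes, so injectivity of
  both projections already says that no vertex is used twice.\<close>

definition cross_matching :: "nat \<Rightarrow> nat \<Rightarrow> ('a \<times> 'a) set \<Rightarrow> bool" where
  "cross_matching i j P \<longleftrightarrow> inj_on fst P \<and> inj_on snd P \<and>
     P \<subseteq> {v \<in> V - Bad. c v = i} \<times> {v \<in> V - Bad. c v = j}"

lemma cross_matchingD:
  assumes "cross_matching i j P"
  shows "fst ` P \<subseteq> {v \<in> V - Bad. c v = i}" "snd ` P \<subseteq> {v \<in> V - Bad. c v = j}"
    "card (fst ` P) = card P" "card (snd ` P) = card P"
  using assms unfolding cross_matching_def by (force, force, blast intro: card_image, blast intro: card_image)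

lemma cross_matching_subset: "cross_matching i j P \<Longrightarrow> Q \<subseteq> P \<Longrightarrow> cross_matching i j Q"
  unfolding cross_matching_def by (auto intro: inj_on_subset)

lemma finite_cross_matching: "cross_matching i j P \<Longrightarrow> finite P"
  unfolding cross_matching_def
  by (rule finite_subset[of _ "V \<times> V"]) (auto simp: finite_V)

text \<open>An edge \<open>x y\<close> would complete \<open>K\<close> to a clique on
  \<open>r + 1\<close> vertices. This is what turns one clique shared by many pairs into
  nonadjacency between all their ends.\<close>

lemma clique_not_extendable:
  assumes K: "K \<subseteq> V" "card K = r - 1" "pairwise adj K"
    and xy: "x \<in> V" "y \<in> V" "\<forall>z\<in>K. adj x z" "\<forall>z\<in>K. adj y z"
  shows "\<not> adj x y"
proof
  assume a: "adj x y"
  have "x \<notin> K" "y \<notin> K" "x \<noteq> y" using xy a adj_irrefl by auto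
  moreover have "finite K" using K finite_V finite_subset by auto
  ultimately have "card (insert x (insert y K)) = Suc r" using K r_pos by simp
  moreover have "pairwise adj (insert x (insert y K))"
    using K xy a adj_sym by (auto simp: pairwise_insert)
  ultimately show False using clique_free[of "insert x (insert y K)"] K xy by auto
qed

lemma sum_missing_ends:
  assumes P: "cross_matching i j P" and "i \<noteq> j"
  shows "(\<Sum>p\<in>P. missing (fst p) + missing (snd p)) = sum missing (fst ` P \<union> snd ` P)"
proof -
  have "fst ` P \<inter> snd ` P = {}"
    using cross_matchingD(1,2)[OF P] \<open>i \<noteq> j\<close> by blast
  then have "sum missing (fst ` P \<union> snd ` P) = sum missing (fst ` P) + sum missing (snd ` P)"
    using finite_cross_matching[OF P] by (intro sum.union_disjoint) auto
  then show ?thesis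
    using P by (simp add: sum.reindex cross_matching_def sum.distrib)
qed

text \<open>Each vertex of \<open>X\<close> misses all of \<open>Y\<close>, which lies in another
  class; counting from the side of \<open>X\<close> suffices.\<close>

lemma missing_ge_product:
  assumes P: "cross_matching i j P" and ij: "i \<noteq> j"
    and X: "X \<subseteq> fst ` P" and Y: "Y \<subseteq> snd ` P" and na: "\<And>x y. x \<in> X \<Longrightarrow> y \<in> Y \<Longrightarrow> \<not> adj x y"
  shows "card X * card Y \<le> (\<Sum>p\<in>P. missing (fst p) + missing (snd p))"
proof -
  have "card Y \<le> missing x" if "x \<in> X" for x
    unfolding missing_def
  proof (rule card_mono)
    show "Y \<subseteq> {y \<in> V. c y \<noteq> c x \<and> \<not> adj x y}"
    proof
      fix y assume y: "y \<in> Y"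
      have "x \<in> fst ` P" "y \<in> snd ` P" using that X Y y by auto
      then have "c x = i" "c y = j" "y \<in> V" using cross_matchingD(1,2)[OF P] by auto
      then show "y \<in> {y \<in> V. c y \<noteq> c x \<and> \<not> adj x y}" using na[OF that y] ij by auto
    qed
  qed (use finite_V in auto)
  then have "card X * card Y \<le> sum missing X"
    using sum_mono[of X "\<lambda>_. card Y" missing] by simp
  also have "\<dots> \<le> sum missing (fst ` P \<union> snd ` P)"
    using X finite_cross_matching[OF P] by (intro sum_mono2) auto
  finally show ?thesis using sum_missing_ends[OF P ij] by simp
qed

text \<open>
  Either some petal is joined completely to half of each side of the matching, which makes these
  halves completely nonadjacent, or every petal is missed by half of a side; missing pairs towards
  distinct petals are distinct.
\<close>

lemma sunflower_missing:
  fixes lam :: real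
  assumes P: "cross_matching i j P" and ij: "i \<noteq> j"
    and K: "\<And>p. p \<in> P \<Longrightarrow> clique_over p (K p)" "\<And>p. p \<in> P \<Longrightarrow> T \<subseteq> K p"
    and F: "F \<subseteq> P" "card F = q" "pairwise (\<lambda>p p'. disjnt (K p - T) (K p' - T)) F"
    and good: "\<And>p. p \<in> F \<Longrightarrow> (K p - T) \<inter> Bad = {}"
    and lam: "0 \<le> lam" "lam \<le> real q / 2"
  shows "lam * real (card P) - lam\<^sup>2 \<le> real (\<Sum>p\<in>P. missing (fst p) + missing (snd p))"
proof -
  define X Y where "X = fst ` P" and "Y = snd ` P"
  \<comment> \<open>The petals are the sets \<open>K f - T\<close>. All ends are joined to
    \<open>T\<close> anyway, so a vertex of \<open>full X f\<close> or \<open>full Y f\<close> is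
    joined to all of \<open>K f\<close>.\<close>
  define full where "full S f = {x \<in> S. \<forall>w\<in>K f - T. adj x w}" for S f
  define hit where "hit u f \<longleftrightarrow> (\<exists>w\<in>K f - T. \<not> adj u w)" for u f
  have finP: "finite P" and finF: "finite F"
    using finite_cross_matching[OF P] F finite_subset by auto
  have cX: "card X = card P" and cY: "card Y = card P"
    using cross_matchingD[OF P] by (auto simp: X_def Y_def)
  have finXY: "finite X" "finite Y" using finP by (auto simp: X_def Y_def)
  have XYV: "X \<subseteq> V - Bad" "Y \<subseteq> V - Bad" using cross_matchingD[OF P] by (auto simp: X_def Y_def)
  have XYT: "adj x z" if "x \<in> X \<union> Y" "z \<in> T" for x z
    using that K by (fastforce simp: X_def Y_def clique_over_def)
  show ?thesis
  proof (cases "\<exists>f\<in>F. 2 * card (full X f) \<ge> card P \<and> 2 * card (full Y f) \<ge> card P")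
    case True
    then obtain f where f: "f \<in> F" "2 * card (full X f) \<ge> card P" "2 * card (full Y f) \<ge> card P"
      by blast
    have cl: "clique_over f (K f)" using K(1) f(1) F(1) by blast
    have na: "\<not> adj x y" if "x \<in> full X f" "y \<in> full Y f" for x y
    proof (rule clique_not_extendable[of "K f"])
      show "\<forall>z\<in>K f. adj x z" "\<forall>z\<in>K f. adj y z"
        using that XYT by (auto simp: full_def)
      show "x \<in> V" "y \<in> V" using that XYV by (auto simp: full_def)
    qed (use cl in \<open>auto simp: clique_over_def\<close>)
    have "card (full X f) * card (full Y f) \<le> (\<Sum>p\<in>P. missing (fst p) + missing (snd p))"
      using na by (intro missing_ge_product[OF P ij]) (auto simp: full_def X_def Y_def)
    moreover have "(real (card P))\<^sup>2 / 4 \<le> real (card (full X f) * card (full Y f))"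
    proof -
      have "real (card P) * real (card P)
          \<le> real (2 * card (full X f)) * real (2 * card (full Y f))"
        using f by (intro mult_mono) linarith+
      then show ?thesis by (simp add: power2_eq_square)
    qed
    moreover have "lam * real (card P) - lam\<^sup>2 \<le> (real (card P))\<^sup>2 / 4"
      by (rule quadratic_ge_linear)
    ultimately show ?thesis unfolding of_nat_le_iff[symmetric, where 'a = real] by linarith
  next
    case False
    \<comment> \<open>On one of the two sides fewer than half of the ends are full for
      \<open>f\<close>, so at least half of that side is hit.\<close>
    have half: "real (card P) / 2 \<le> real (card {u \<in> X \<union> Y. hit u f})" if "f \<in> F" for f
    proof -
      have *: "card P \<le> 2 * card {u \<in> X \<union> Y. hit u f}"
        if S: "S = X \<or> S = Y" "2 * card (full S f) < card P" for S
      proof -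
        have "card S = card P" "finite S" using S cX cY finXY by auto
        moreover have "card (S - full S f) = card S - card (full S f)"
          using \<open>finite S\<close> by (intro card_Diff_subset) (auto simp: full_def)
        moreover have "card (S - full S f) \<le> card {u \<in> X \<union> Y. hit u f}"
          using S finXY by (intro card_mono) (auto simp: full_def hit_def)
        ultimately show ?thesis using S by linarith
      qed
      have "card P \<le> 2 * card {u \<in> X \<union> Y. hit u f}"
        using False that *[of X] *[of Y] by (meson not_le_imp_less)
      then show ?thesis by linarith
    qed
    \<comment> \<open>Each petal hitting \<open>u\<close> contributes a nonneighbour of
      \<open>u\<close>, and disjointness of the petals makes these distinct.\<close>
    have mis: "card {f \<in> F. hit u f} \<le> missing u" if u: "u \<in> X \<union> Y" for u
    proof -
      define w where "w f = (SOME w. w \<in> K f - T \<and> \<not> adj u w)" for f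
      have w: "w f \<in> K f - T \<and> \<not> adj u (w f)" if "hit u f" for f
        unfolding w_def by (rule someI_ex) (use that in \<open>auto simp: hit_def\<close>)
      have cu: "c u = i \<or> c u = j" using u cross_matchingD(1,2)[OF P] by (auto simp: X_def Y_def)
      show ?thesis unfolding missing_def
      proof (rule card_inj_on_le)
        show "inj_on w {f \<in> F. hit u f}"
        proof (rule inj_onI)
          fix f g assume "f \<in> {f \<in> F. hit u f}" "g \<in> {f \<in> F. hit u f}" "w f = w g"
          then show "f = g"
            using w[of f] w[of g] F(3) by (fastforce simp: pairwise_def disjnt_def)
        qed
        show "w ` {f \<in> F. hit u f} \<subseteq> {y \<in> V. c y \<noteq> c u \<and> \<not> adj u y}"
        proof (rule image_subsetI)
          fix f assume "f \<in> {f \<in> F. hit u f}"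
          then have f: "f \<in> F" "w f \<in> K f - T" "\<not> adj u (w f)" using w by auto
          have fP: "f \<in> P" using f F by auto
          then have cl: "adj (fst f) (w f)" "adj (snd f) (w f)" "w f \<in> V"
            using K(1)[of f] f by (auto simp: clique_over_def)
          \<comment> \<open>The petal vertex is good and adjacent to the good ends of
            \<open>f\<close>, so its class is neither \<open>i\<close> nor \<open>j\<close>. The
            pair it forms with \<open>u\<close> is therefore a cross pair.\<close>
          have "w f \<in> V - Bad" using good[OF f(1)] f cl by auto
          moreover have "fst f \<in> V - Bad" "snd f \<in> V - Bad" "c (fst f) = i" "c (snd f) = j"
            using cross_matchingD(1,2)[OF P] fP by auto
          ultimately have "c (w f) \<noteq> i" "c (w f) \<noteq> j"
            using good_independent cl by metis+
          then show "w f \<in> {y \<in> V. c y \<noteq> c u \<and> \<not> adj u y}" using cu cl f by auto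
        qed
      qed (use finite_V in auto)
    qed
    have "lam * real (card P) - lam\<^sup>2 \<le> real q / 2 * real (card P)"
      using mult_right_mono[OF lam(2), of "real (card P)"] by (smt (verit) of_nat_0_le_iff zero_le_power2)
    also have "\<dots> = (\<Sum>f\<in>F. real (card P) / 2)" using F by simp
    \<comment> \<open>The pairs of an end \<open>u\<close> and a petal hitting it are now counted
      from both sides.\<close>
    also have "\<dots> \<le> (\<Sum>f\<in>F. real (card {u \<in> X \<union> Y. hit u f}))" by (intro sum_mono half)
    also have "\<dots> = real (\<Sum>f\<in>F. \<Sum>u\<in>X \<union> Y. if hit u f then 1 else 0)"
      using finXY by (simp add: sum.If_cases Int_def)
    also have "\<dots> = real (\<Sum>u\<in>X \<union> Y. \<Sum>f\<in>F. if hit u f then 1 else 0)"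
      by (subst sum.swap) simp
    also have "\<dots> = real (\<Sum>u\<in>X \<union> Y. card {f \<in> F. hit u f})"
      using finF by (simp add: sum.If_cases Int_def)
    also have "\<dots> \<le> real (sum missing (X \<union> Y))"
      using mis by (intro of_nat_mono sum_mono) auto
    finally show ?thesis using sum_missing_ends[OF P ij] by (simp add: X_def Y_def)
  qed
qed

text \<open>
  The bound is linear in \<open>card P\<close>, hence additive over the branches, whereas the bound \<open>(card P)\<^sup>2 / 4\<close>
  it comes from is not.
\<close>

lemma matching_missing:
  fixes lam :: real
  assumes ij: "i \<noteq> j" and lam: "0 \<le> lam" "lam \<le> real q / 2"
    and b: "card Bad + (r - 1) * q \<le> b" "b \<ge> 1"
  shows "cross_matching i j P \<Longrightarrow> (\<And>p. p \<in> P \<Longrightarrow> clique_over p (K p)) \<Longrightarrow>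
    (\<And>p. p \<in> P \<Longrightarrow> T \<subseteq> K p) \<Longrightarrow> card T + s = r - 1 \<Longrightarrow>
    lam * real (card P) - lam\<^sup>2 * real b ^ s \<le> real (\<Sum>p\<in>P. missing (fst p) + missing (snd p))"
proof (induction s arbitrary: P T)
  case 0
  note P = 0(1)
  show ?case
  proof (cases "P = {}")
    case False
    then obtain p0 where p0: "p0 \<in> P" by auto
    \<comment> \<open>No rounds are left: \<open>T\<close> has the full size \<open>r - 1\<close>,
      so a single clique lies over all pairs of \<open>P\<close>.\<close>
    have KT: "K p = T" if "p \<in> P" for p
      using 0(2)[OF that] 0(3)[OF that] 0(4) finite_V
      by (metis card_subset_eq clique_over_def finite_subset add_0_right)
    have "\<not> adj x y" if xy: "x \<in> fst ` P" "y \<in> snd ` P" for x y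
    proof (rule clique_not_extendable[of "K p0"])
      show "\<forall>z\<in>K p0. adj x z" "\<forall>z\<in>K p0. adj y z"
        using xy 0(2) KT[OF p0] KT by (fastforce simp: clique_over_def)+
      show "x \<in> V" "y \<in> V" using cross_matchingD(1,2)[OF P] xy by auto
    qed (use 0(2)[OF p0] in \<open>auto simp: clique_over_def\<close>)
    then have "card (fst ` P) * card (snd ` P) \<le> (\<Sum>p\<in>P. missing (fst p) + missing (snd p))"
      by (intro missing_ge_product[OF P ij]) auto
    moreover have "card (fst ` P) = card P" "card (snd ` P) = card P"
      by (rule cross_matchingD[OF P])+
    ultimately have "(real (card P))\<^sup>2 \<le> real (\<Sum>p\<in>P. missing (fst p) + missing (snd p))"
      unfolding power2_eq_square by (metis of_nat_le_iff of_nat_mult)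
    moreover have "lam * real (card P) - lam\<^sup>2 \<le> (real (card P))\<^sup>2 / 4"
      by (rule quadratic_ge_linear)
    moreover have "(real (card P))\<^sup>2 / 4 \<le> (real (card P))\<^sup>2" by simp
    ultimately show ?thesis unfolding power_0 mult_1_right by linarith
  qed simp
next
  case (Suc s)
  note P = Suc.prems(1)
  let ?g = "\<lambda>p. missing (fst p) + missing (snd p)"
  let ?fam = "\<lambda>F. F \<subseteq> {p \<in> P. (K p - T) \<inter> Bad = {}} \<and> pairwise (\<lambda>p p'. disjnt (K p - T) (K p' - T)) F"
  have finP: "finite P" by (rule finite_cross_matching[OF P])
  have b1: "1 \<le> real b ^ n" for n using b by simp
  have Kf: "finite (K p)" "card (K p) = r - 1" if "p \<in> P" for p
    using Suc.prems(2)[OF that] finite_V finite_subset by (auto simp: clique_over_def)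
  show ?case
  proof (cases "\<exists>F. ?fam F \<and> card F = q")
    case True
    then obtain F where F: "?fam F" "card F = q" by blast
    have "lam * real (card P) - lam\<^sup>2 \<le> real (sum ?g P)"
      by (rule sunflower_missing[OF P ij Suc.prems(2,3) _ F(2) _ _ lam]) (use F(1) in auto)
    moreover have "lam\<^sup>2 * 1 \<le> lam\<^sup>2 * real b ^ Suc s" by (intro mult_left_mono b1) simp
    ultimately show ?thesis by linarith
  next
    case False
    have fin_fams: "finite {F. ?fam F}" using finP by (auto intro: finite_subset[of _ "Pow P"])
    have "{F. ?fam F} \<noteq> {}" by (auto intro!: exI[of _ "{}"])
    \<comment> \<open>Maximality under inclusion is enough: the family has fewer than
      \<open>q\<close> members, since a larger one would contain a subfamily of exactly
      \<open>q\<close>.\<close>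
    then obtain F where F: "?fam F" and Fmax: "\<And>G. ?fam G \<Longrightarrow> F \<subseteq> G \<Longrightarrow> G = F"
      using finite_has_maximal[OF fin_fams] by (metis (mono_tags, lifting) mem_Collect_eq)
    have FP: "F \<subseteq> P" using F by auto
    have finF: "finite F" by (rule finite_subset[OF FP finP])
    have "card F < q"
    proof (rule ccontr)
      assume "\<not> card F < q"
      then obtain G where G: "G \<subseteq> F" "card G = q" using obtain_subset_with_card_n[of q F] by auto
      then have "?fam G" using F by (auto intro: pairwise_subset)
      then show False using False G by blast
    qed
    define U where "U = Bad \<union> (\<Union>p\<in>F. K p - T)"
    have finU: "finite U"
    proof -
      have "finite (K p - T)" if "p \<in> F" for p using Kf(1)[of p] FP that by auto
      then have "finite (\<Union>p\<in>F. K p - T)" by (intro finite_UN_I[OF finF])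
      then show ?thesis using finite_subset[OF Bad_subset finite_V] by (simp add: U_def)
    qed
    have "card (\<Union>p\<in>F. K p - T) \<le> (\<Sum>p\<in>F. card (K p - T))"
      using finF by (rule card_UN_le)
    also have "\<dots> \<le> (\<Sum>p\<in>F. r - 1)"
    proof (rule sum_mono)
      fix p assume "p \<in> F"
      then have "p \<in> P" using F by auto
      then show "card (K p - T) \<le> r - 1"
        using Kf[of p] card_mono[of "K p" "K p - T"] by auto
    qed
    also have "\<dots> \<le> (r - 1) * q" using \<open>card F < q\<close> by simp
    finally have cU: "card U \<le> b"
      using b(1) card_Un_le[of Bad "\<Union>p\<in>F. K p - T"] by (simp add: U_def)
    \<comment> \<open>A petal avoiding \<open>U\<close> could be added to \<open>F\<close>, so it
      already belongs to \<open>F\<close> and lies in \<open>U\<close>. It would thus be empty, but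
      \<open>K p\<close> is larger than \<open>T\<close> as long as a round remains.\<close>
    have meets: "\<exists>u. u \<in> U \<and> u \<in> K p - T" if p: "p \<in> P" for p
    proof (rule ccontr)
      assume neg: "\<not> ?thesis"
      have "?fam (insert p F)"
        using neg F p by (auto simp: pairwise_insert disjnt_def U_def)
      then have "p \<in> F" using Fmax[of "insert p F"] by auto
      then have "K p - T = {}" using neg by (auto simp: U_def)
      then have "K p = T" using Suc.prems(3)[OF p] by auto
      then show False using Kf[OF p] Suc.prems(4) by simp
    qed
    then obtain sel where sel: "\<And>p. p \<in> P \<Longrightarrow> sel p \<in> U \<and> sel p \<in> K p - T" by metis
    \<comment> \<open>One branch for each chosen vertex \<open>u\<close>, which joins the common
      part \<open>T\<close>.\<close>
    define Q where "Q u = {p \<in> P. sel p = u}" for u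
    have branch: "lam * real (card (Q u)) - lam\<^sup>2 * real b ^ s \<le> real (sum ?g (Q u))" for u
    proof (cases "Q u = {}")
      case True
      then show ?thesis by simp
    next
      case False
      then obtain p where p: "p \<in> P" "sel p = u" by (auto simp: Q_def)
      have "finite T" using Suc.prems(3)[OF p(1)] Kf[OF p(1)] finite_subset by blast
      moreover have "u \<notin> T" using sel[OF p(1)] p(2) by auto
      ultimately have "card (insert u T) + s = r - 1" using Suc.prems(4) by simp
      then show ?thesis
        using cross_matching_subset[OF P, of "Q u"] Suc.prems(2,3) sel
        by (intro Suc.IH[of "Q u" "insert u T"]) (auto simp: Q_def)
    qed
    have part: "sum f P = (\<Sum>u\<in>U. sum f (Q u))" for f :: "'a \<times> 'a \<Rightarrow> nat"
      unfolding Q_def using finP finU sel by (intro sum.group[symmetric]) auto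
    have cP: "card P = (\<Sum>u\<in>U. card (Q u))" using part[of "\<lambda>_. 1"] by simp
    \<comment> \<open>There are at most \<open>b\<close> branches, and each loses
      \<open>lam\<^sup>2 * real b ^ s\<close>; the linear main terms add up exactly.\<close>
    have "lam\<^sup>2 * real b ^ s * real (card U) \<le> lam\<^sup>2 * real b ^ s * real b"
      using cU by (intro mult_left_mono) auto
    then have "lam * real (card P) - lam\<^sup>2 * real b ^ Suc s
        \<le> lam * real (card P) - lam\<^sup>2 * real b ^ s * real (card U)" by (simp add: mult_ac)
    also have "\<dots> = (\<Sum>u\<in>U. lam * real (card (Q u)) - lam\<^sup>2 * real b ^ s)"
      unfolding cP by (simp add: sum_subtractf sum_distrib_left)
    also have "\<dots> \<le> (\<Sum>u\<in>U. real (sum ?g (Q u)))" by (intro sum_mono branch)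
    also have "\<dots> = real (sum ?g P)" by (subst part) simp
    finally show ?thesis .
  qed
qed

text \<open>The ends of a maximal matching of nonadjacent pairs form such a cover, and
  \<open>matching_missing\<close> bounds the size of the matching.\<close>

lemma nonadjacent_cover:
  assumes ij: "i \<noteq> j" and q: "q \<ge> 1" and b: "card Bad + (r - 1) * q \<le> b" "b \<ge> 1"
    and sat: "\<And>x y. x \<in> V \<Longrightarrow> y \<in> V \<Longrightarrow> x \<noteq> y \<Longrightarrow> \<not> adj x y \<Longrightarrow> \<exists>K. clique_over (x, y) K"
  shows "\<exists>W\<subseteq>V. real (card W) \<le> 4 * real (sum missing V) / real q + real q * real b ^ (r - 1) \<and>
    (\<forall>x\<in>V - Bad - W. \<forall>y\<in>V - Bad - W. c x = i \<and> c y = j \<longrightarrow> adj x y)"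
proof -
  define fam where "fam = {P. cross_matching i j P \<and> (\<forall>p\<in>P. \<not> adj (fst p) (snd p))}"
  have "fam \<subseteq> Pow (V \<times> V)"
    unfolding fam_def cross_matching_def by auto
  then have "finite fam" by (rule finite_subset) (simp add: finite_V)
  moreover have "{} \<in> fam" by (simp add: fam_def cross_matching_def)
  ultimately obtain P where P: "P \<in> fam" and Pmax: "\<And>Q. Q \<in> fam \<Longrightarrow> P \<subseteq> Q \<Longrightarrow> Q = P"
    using finite_has_maximal[of fam] by (metis empty_iff)
  have cm: "cross_matching i j P" and na: "\<And>p. p \<in> P \<Longrightarrow> \<not> adj (fst p) (snd p)"
    using P by (auto simp: fam_def)
  note ends = cross_matchingD[OF cm]
  define W where "W = fst ` P \<union> snd ` P"
  have WV: "W \<subseteq> V" using ends(1,2) by (auto simp: W_def)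
  have "\<exists>K. clique_over p K" if p: "p \<in> P" for p
  proof -
    have "fst p \<in> fst ` P" "snd p \<in> snd ` P" using p by auto
    then have "fst p \<in> V" "snd p \<in> V" "c (fst p) = i" "c (snd p) = j" using ends(1,2) by blast+
    moreover from this have "fst p \<noteq> snd p" using ij by auto
    ultimately show ?thesis using sat[of "fst p" "snd p"] na[OF p] by simp
  qed
  then obtain K where K: "\<And>p. p \<in> P \<Longrightarrow> clique_over p (K p)" by metis
  have "real q / 2 * real (card P) - (real q / 2)\<^sup>2 * real b ^ (r - 1)
      \<le> real (\<Sum>p\<in>P. missing (fst p) + missing (snd p))"
    \<comment> \<open>The branching starts from the empty common part with \<open>r - 1\<close>
      rounds and the largest admissible slope \<open>lam = real q / 2\<close>.\<close>
    by (rule matching_missing[OF ij _ _ b cm K, where T = "{}"]) auto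
  also have "\<dots> = real (sum missing W)" using sum_missing_ends[OF cm ij] by (simp add: W_def)
  also have "\<dots> \<le> real (sum missing V)"
    using sum_mono2[OF finite_V WV, of missing] by (intro of_nat_mono) simp
  finally have "real (card P) * (real q / 2) \<le> real (sum missing V) + (real q / 2)\<^sup>2 * real b ^ (r - 1)"
    by (simp add: mult.commute)
  then have "real (card P) \<le> (real (sum missing V) + (real q / 2)\<^sup>2 * real b ^ (r - 1)) / (real q / 2)"
    using q by (simp add: pos_le_divide_eq)
  also have "\<dots> = 2 * real (sum missing V) / real q + real q / 2 * real b ^ (r - 1)"
    using q by (simp add: field_simps power2_eq_square)
  finally have "2 * real (card P) \<le> 4 * real (sum missing V) / real q + real q * real b ^ (r - 1)"
    by simp
  moreover have "card W \<le> 2 * card P"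
    using card_Un_le[of "fst ` P" "snd ` P"] ends(3,4) by (simp add: W_def)
  ultimately have cW: "real (card W) \<le> 4 * real (sum missing V) / real q + real q * real b ^ (r - 1)"
    by linarith
  have "adj x y" if xy: "x \<in> V - Bad - W" "y \<in> V - Bad - W" "c x = i" "c y = j" for x y
  proof (rule ccontr)
    assume nadj: "\<not> adj x y"
    have nin: "x \<notin> fst ` P" "y \<notin> snd ` P" using xy by (auto simp: W_def)
    have "cross_matching i j (insert (x, y) P)"
      unfolding cross_matching_def
    proof (intro conjI)
      show "insert (x, y) P \<subseteq> {v \<in> V - Bad. c v = i} \<times> {v \<in> V - Bad. c v = j}"
        using xy cm unfolding cross_matching_def by simp
    qed (use cm nin in \<open>auto simp: cross_matching_def\<close>)
    \<comment> \<open>A nonadjacent pair outside \<open>W\<close> would enlarge the maximal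
      matching.\<close>
    then have "insert (x, y) P \<in> fam" using P nadj by (auto simp: fam_def)
    then have "(x, y) \<in> P" using Pmax[of "insert (x, y) P"] by auto
    then show False using nin by force
  qed
  then show ?thesis using WV cW by blast
qed

end

section \<open>Saturated graphs close to the Turan bound\<close>

text \<open>Two adjacent vertices of one class extend greedily by a vertex from each other class to
  a clique on \<open>r + 1\<close> vertices. At most \<open>r\<close> chosen vertices exclude at
  most \<open>d\<close> candidates each, fewer than the next class offers.\<close>

lemma good_vertices_independent:
  fixes c :: "'a \<Rightarrow> nat" and adj :: "'a \<Rightarrow> 'a \<Rightarrow> bool"
  assumes fin: "finite V" and sym: "\<And>x y. adj x y \<Longrightarrow> adj y x" and irrefl: "\<And>x. \<not> adj x x"
    and cf: "\<And>K. K \<subseteq> V \<Longrightarrow> pairwise adj K \<Longrightarrow> card K \<noteq> Suc r"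
    and G: "G \<subseteq> V" "\<And>v. v \<in> G \<Longrightarrow> c v < r"
    and mis: "\<And>v. v \<in> G \<Longrightarrow> card {y \<in> V. c y \<noteq> c v \<and> \<not> adj v y} \<le> d"
    and big: "\<And>l. l < r \<Longrightarrow> r * d < card {v \<in> G. c v = l}"
    and xz: "x \<in> G" "z \<in> G" "c x = c z"
  shows "\<not> adj x z"
proof
  assume a: "adj x z"
  have extend: "\<exists>v\<in>G. c v = l \<and> (\<forall>s\<in>S. adj s v)"
    if S: "S \<subseteq> G" "card S \<le> r" "l \<notin> c ` S" "l < r" for S l
  proof (rule ccontr)
    assume neg: "\<not> ?thesis"
    have finS: "finite S" using S G fin finite_subset by metis
    have "{v \<in> G. c v = l} \<subseteq> (\<Union>s\<in>S. {y \<in> V. c y \<noteq> c s \<and> \<not> adj s y})"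
      using neg S G by fastforce
    then have "card {v \<in> G. c v = l} \<le> card (\<Union>s\<in>S. {y \<in> V. c y \<noteq> c s \<and> \<not> adj s y})"
      using finS fin by (intro card_mono) auto
    also have "\<dots> \<le> (\<Sum>s\<in>S. card {y \<in> V. c y \<noteq> c s \<and> \<not> adj s y})"
      by (rule card_UN_le[OF finS])
    also have "\<dots> \<le> (\<Sum>s\<in>S. d)" using S by (intro sum_mono mis) auto
    also have "\<dots> \<le> r * d" using S by simp
    finally show False using big[OF S(4)] by simp
  qed
  have cx: "c x < r" using G xz by auto
  \<comment> \<open>\<open>L\<close> collects the further classes already used; the
    \<open>+ 2\<close> stands for \<open>x\<close> and \<open>z\<close>, which share the class
    \<open>c x\<close>.\<close>
  have clique: "\<exists>S\<subseteq>G. pairwise adj S \<and> card S = card L + 2 \<and> c ` S = insert (c x) L"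
    if "finite L" "L \<subseteq> {..<r} - {c x}" for L
    using that
  proof (induction L)
    case empty
    have "x \<noteq> z" using a irrefl by auto
    then show ?case
      using xz a sym by (intro exI[of _ "{x, z}"]) (auto simp: pairwise_insert)
  next
    case (insert l L)
    then obtain S where S: "S \<subseteq> G" "pairwise adj S" "card S = card L + 2" "c ` S = insert (c x) L"
      by auto
    have finS: "finite S" using S G fin finite_subset by metis
    have "card (insert l L) \<le> card ({..<r} - {c x})"
      using insert.prems by (intro card_mono) auto
    then have "card S \<le> r" using S insert.hyps cx by simp
    moreover have lS: "l \<notin> c ` S" "l < r" using S insert by auto
    ultimately obtain v where v: "v \<in> G" "c v = l" "\<forall>s\<in>S. adj s v"
      using extend[OF S(1)] by blast
    have "v \<notin> S" using lS v by auto
    then show ?case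
      using S v sym insert.hyps finS
      by (intro exI[of _ "insert v S"]) (auto simp: pairwise_insert)
  qed
  obtain S where S: "S \<subseteq> G" "pairwise adj S" "card S = card ({..<r} - {c x}) + 2"
    using clique[of "{..<r} - {c x}"] by auto
  have "card S = Suc r" using S(3) cx by simp
  then show False using cf[of S] S G by auto
qed

text \<open>The clique created by the new edge contains both its ends, as otherwise it would already
  lie in the graph. Removing the ends leaves the required set.\<close>

lemma saturated_clique_over_nonedge:
  assumes sat: "saturated (r + 1) V E" and r: "r > 0" and V: "finite V"
    and xy: "x \<in> V" "y \<in> V" "x \<noteq> y" "{x, y} \<notin> E"
  shows "\<exists>K\<subseteq>V. card K = r - 1 \<and> pairwise (\<lambda>u v. {u, v} \<in> E) K \<and>
    (\<forall>z\<in>K. {x, z} \<in> E \<and> {y, z} \<in> E)"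
proof -
  obtain K where K: "K \<subseteq> V" "card K = r + 1"
      "\<And>u v. u \<in> K \<Longrightarrow> v \<in> K \<Longrightarrow> u \<noteq> v \<Longrightarrow> {u, v} \<in> insert {x, y} E"
    using sat xy unfolding saturated_def contains_clique_def by (metis (no_types, lifting))
  have xyK: "x \<in> K \<and> y \<in> K"
  proof (rule ccontr)
    assume "\<not> ?thesis"
    then have "\<forall>u\<in>K. \<forall>v\<in>K. u \<noteq> v \<longrightarrow> {u, v} \<in> E"
      using K(3) by (metis doubleton_eq_iff insert_iff)
    then show False using sat K unfolding saturated_def contains_clique_def by blast
  qed
  have "{u, v} \<in> E" if "u \<in> K" "v \<in> K - {x, y}" "u \<noteq> v" for u v
    using K(3)[of u v] that by (auto simp: doubleton_eq_iff)
  then show ?thesis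
    using K xyK xy V finite_subset[OF K(1) V]
    by (intro exI[of _ "K - {x, y}"]) (auto simp: pairwise_def card_Diff_subset)
qed

text \<open>The quantitative form, with \<open>q\<close> still free. \<open>B\<close> bounds the
  number of bad vertices, and the factor \<open>(real r)\<^sup>2\<close> accounts for one cover per
  ordered pair of classes.\<close>

lemma large_complete_multipartite:
  fixes V :: "'a set" and M :: real
  assumes r: "r \<ge> 2" and g: "simple_graph V E" "card V = n" "saturated (r + 1) V E"
    and e: "real (card E) \<ge> real (turan_size r n) - M"
    and n: "n \<ge> 1" and q: "q \<ge> 1"
    and B: "B = 16 * (real r)\<^sup>2 * M / real n" "B < real n / (4 * real r)"
    and dev: "real r + 2 * M \<le> (real n / (2 * real r))\<^sup>2"
  shows "\<exists>U\<subseteq>V. complete_multipartite r U (induced_edges U E) \<and>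
    real (card U) \<ge> real n -
      (B + (real r)\<^sup>2 * (16 * M / real q + real q * (B + real r * real q) ^ (r - 1)))"
proof -
  define adj where "adj x y \<longleftrightarrow> {x, y} \<in> E" for x y
  have r0: "r > 0" using r by simp
  have finV: "finite V" and edges: "\<forall>e\<in>E. e \<subseteq> V \<and> card e = 2"
    using g(1) by (auto simp: simple_graph_def)
  have sym: "adj x y \<Longrightarrow> adj y x" for x y by (simp add: adj_def insert_commute)
  have irrefl: "\<not> adj x x" for x using edges by (auto simp: adj_def)
  have cf: "card K \<noteq> Suc r" if "K \<subseteq> V" "pairwise adj K" for K
  proof
    assume "card K = Suc r"
    then have "contains_clique (r + 1) V E"
      unfolding contains_clique_def using that by (intro exI[of _ K]) (auto simp: pairwise_def adj_def)
    then show False using g(3) by (simp add: saturated_def)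
  qed
  obtain c :: "'a \<Rightarrow> nat" where c: "\<forall>v\<in>V. c v < r"
    and fu: "card {(x, y) \<in> V \<times> V. adj x y} + card {(x, y) \<in> V \<times> V. adj x y \<and> c x = c y}
      \<le> card {(x, y) \<in> V \<times> V. c x \<noteq> c y}"
    using furedi_stability[of V adj r, OF finV sym irrefl cf] by blast
  define missing where "missing x = card {y \<in> V. c y \<noteq> c x \<and> \<not> adj x y}" for x
  have fp: "finite {(x, y) \<in> V \<times> V. Q x y}" for Q
    by (rule finite_subset[of _ "V \<times> V"]) (use finV in auto)
  have eG: "card {(x, y) \<in> V \<times> V. adj x y} = 2 * card E"
    unfolding adj_def by (rule card_ordered_pairs[OF finV edges])
  have eK: "card {(x, y) \<in> V \<times> V. c x \<noteq> c y} = 2 * card (multipartite_edges c V)"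
    by (rule card_multipartite_edges[OF finV])
  have turan: "card (multipartite_edges c V) \<le> turan_size r n"
    using card_multipartite_edges_le_turan[OF finV c] r g(2) by simp
  have total: "real (sum missing V) \<le> 4 * M"
  proof -
    have "sum missing V = card (SIGMA x:V. {y \<in> V. c y \<noteq> c x \<and> \<not> adj x y})"
      using finV by (simp add: missing_def)
    also have "(SIGMA x:V. {y \<in> V. c y \<noteq> c x \<and> \<not> adj x y})
        = {(x, y) \<in> V \<times> V. c x \<noteq> c y \<and> \<not> adj x y}" by auto
    finally have s: "sum missing V = card {(x, y) \<in> V \<times> V. c x \<noteq> c y \<and> \<not> adj x y}" .
    have "{(x, y) \<in> V \<times> V. c x \<noteq> c y} = {(x, y) \<in> V \<times> V. c x \<noteq> c y \<and> \<not> adj x y}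
        \<union> {(x, y) \<in> V \<times> V. c x \<noteq> c y \<and> adj x y}" by auto
    then have 1: "card {(x, y) \<in> V \<times> V. c x \<noteq> c y} = sum missing V +
        card {(x, y) \<in> V \<times> V. c x \<noteq> c y \<and> adj x y}"
      unfolding s by (simp only:) (rule card_Un_disjoint[OF fp fp], auto)
    have "{(x, y) \<in> V \<times> V. adj x y} = {(x, y) \<in> V \<times> V. adj x y \<and> c x = c y}
        \<union> {(x, y) \<in> V \<times> V. c x \<noteq> c y \<and> adj x y}" by auto
    then have 2: "card {(x, y) \<in> V \<times> V. adj x y} = card {(x, y) \<in> V \<times> V. adj x y \<and> c x = c y} +
        card {(x, y) \<in> V \<times> V. c x \<noteq> c y \<and> adj x y}"
      by (simp only:) (rule card_Un_disjoint[OF fp fp], auto)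
    \<comment> \<open>By \<open>turan\<close> and \<open>e\<close>, the ordered cross pairs exceed
      the ordered edges by at most \<open>2 * M\<close>. By \<open>fu\<close> this also bounds the
      edges inside classes, so at most \<open>2 * M + 2 * M\<close> cross pairs are missing.\<close>
    show ?thesis using 1 2 fu eG eK turan e by linarith
  qed
  \<comment> \<open>Each class will have at least \<open>n / (2 * r)\<close> vertices. Half of this
    is reserved for bad vertices, and the other half is at least \<open>r * d\<close>, as the greedy
    extension requires.\<close>
  define d where "d = n div (4 * r\<^sup>2)"
  define Bad where "Bad = {v \<in> V. missing v > d}"
  have BadV: "Bad \<subseteq> V" by (auto simp: Bad_def)
  have finBad: "finite Bad" by (rule finite_subset[OF BadV finV])
  have cBad: "real (card Bad) \<le> B"
  proof -
    have "real (card Bad) * (real d + 1) = (\<Sum>v\<in>Bad. real d + 1)" by simp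
    also have "\<dots> \<le> (\<Sum>v\<in>Bad. real (missing v))"
      by (intro sum_mono) (auto simp: Bad_def)
    also have "\<dots> \<le> (\<Sum>v\<in>V. real (missing v))"
      using finV BadV by (intro sum_mono2) auto
    also have "\<dots> \<le> 4 * M" using total by simp
    finally have up: "real (card Bad) * (real d + 1) \<le> 4 * M" .
    have "n < (d + 1) * (4 * r\<^sup>2)"
      using r unfolding d_def by (metis Suc_eq_plus1 dividend_less_div_times mult_pos_pos
          add.commute mult_Suc zero_less_numeral zero_less_power less_le_trans pos2)
    then have "real n \<le> real ((d + 1) * (4 * r\<^sup>2))" by linarith
    also have "\<dots> = (real d + 1) * (4 * (real r)\<^sup>2)" by (simp add: algebra_simps)
    finally have "real n \<le> (real d + 1) * (4 * (real r)\<^sup>2)" .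
    then have "real (card Bad) * real n \<le> real (card Bad) * ((real d + 1) * (4 * (real r)\<^sup>2))"
      by (intro mult_left_mono) auto
    also have "\<dots> = real (card Bad) * (real d + 1) * (4 * (real r)\<^sup>2)" by simp
    also have "\<dots> \<le> 4 * M * (4 * (real r)\<^sup>2)" using up by (intro mult_right_mono) auto
    finally show ?thesis using n unfolding B(1) by (simp add: field_simps)
  qed
  have indep: "\<not> adj x y" if "x \<in> V - Bad" "y \<in> V - Bad" "c x = c y" for x y
  proof (rule good_vertices_independent[of V adj r "V - Bad" c d, OF finV sym irrefl cf])
    fix l assume l: "l < r"
    \<comment> \<open>So the complete multipartite graph of the partition also has almost
      \<open>turan_size r n\<close> edges, which makes its classes nearly balanced.\<close>
    have "card E \<le> card (multipartite_edges c V)" using fu eG eK by linarith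
    then have "(real (card {v \<in> V. c v = l}) - real n / real r)\<^sup>2 \<le> real r + 2 * M"
      using class_size_deviation[OF finV c l, of M] e g(2) by simp
    then have "(real (card {v \<in> V. c v = l}) - real n / real r)\<^sup>2 \<le> (real n / (2 * real r))\<^sup>2"
      using dev by linarith
    then have "\<bar>real (card {v \<in> V. c v = l}) - real n / real r\<bar> \<le> \<bar>real n / (2 * real r)\<bar>"
      by (simp only: abs_le_square_iff)
    then have "\<bar>real (card {v \<in> V. c v = l}) - real n / real r\<bar> \<le> real n / (2 * real r)" by simp
    moreover have "real n / real r = 2 * (real n / (2 * real r))" by simp
    ultimately have 1: "real (card {v \<in> V. c v = l}) \<ge> real n / (2 * real r)" by linarith
    have "{v \<in> V. c v = l} \<subseteq> {v \<in> V - Bad. c v = l} \<union> Bad" by auto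
    then have "card {v \<in> V. c v = l} \<le> card ({v \<in> V - Bad. c v = l} \<union> Bad)"
      using finV finBad by (intro card_mono) auto
    then have 2: "card {v \<in> V. c v = l} \<le> card {v \<in> V - Bad. c v = l} + card Bad"
      using card_Un_le le_trans by blast
    have "d * (4 * r\<^sup>2) \<le> n" by (simp add: d_def)
    then have "real (d * (4 * r\<^sup>2)) \<le> real n" by linarith
    then have 3: "real (r * d) \<le> real n / (4 * real r)"
      using r by (simp add: field_simps power2_eq_square)
    have "real n / (2 * real r) = 2 * (real n / (4 * real r))" by simp
    then show "r * d < card {v \<in> V - Bad. c v = l}"
      using 1 2 3 cBad B(2) by linarith
  qed (use that c in \<open>auto simp: Bad_def missing_def\<close>)
  interpret G: partitioned_graph V adj r c Bad
    by unfold_locales (rule finV sym irrefl cf r0 BadV indep; assumption)+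
  have mis: "G.missing = missing" by (simp add: fun_eq_iff G.missing_def missing_def)
  define b where "b = card Bad + (r - 1) * q"
  define mu where "mu = 16 * M / real q + real q * (B + real r * real q) ^ (r - 1)"
  have b': "card Bad + (r - 1) * q \<le> b" by (simp add: b_def)
  have b: "b \<ge> 1" using r q by (simp add: b_def Suc_le_eq)
  have "real ((r - 1) * q) \<le> real (r * q)" by (intro of_nat_mono mult_right_mono) auto
  then have rb: "real b \<le> B + real r * real q" using cBad by (simp add: b_def)
  have sat: "\<exists>K. G.clique_over (x, y) K" if xy: "x \<in> V" "y \<in> V" "x \<noteq> y" "\<not> adj x y" for x y
  proof -
    obtain K where K: "K \<subseteq> V" "card K = r - 1" "pairwise (\<lambda>u v. {u, v} \<in> E) K"
        "\<forall>z\<in>K. {x, z} \<in> E \<and> {y, z} \<in> E"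
      using saturated_clique_over_nonedge[OF g(3) r0 finV xy(1-3)] xy(4)
      unfolding adj_def by blast
    then show ?thesis
      by (intro exI[of _ K]) (simp add: G.clique_over_def pairwise_def adj_def)
  qed
  have "\<exists>W\<subseteq>V. real (card W) \<le> mu \<and>
    (\<forall>x\<in>V - Bad - W. \<forall>y\<in>V - Bad - W. c x = i \<and> c y = j \<longrightarrow> adj x y)"
    if ij: "i \<noteq> j" for i j
  proof -
    have "4 * real (sum missing V) / real q \<le> 16 * M / real q"
      using total by (intro divide_right_mono) auto
    moreover have "real q * real b ^ (r - 1) \<le> real q * (B + real r * real q) ^ (r - 1)"
      using rb by (intro mult_left_mono power_mono) auto
    ultimately have "4 * real (sum missing V) / real q + real q * real b ^ (r - 1) \<le> mu"
      unfolding mu_def by linarith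
    moreover have "\<exists>W\<subseteq>V. real (card W) \<le> 4 * real (sum missing V) / real q + real q * real b ^ (r - 1) \<and>
        (\<forall>x\<in>V - Bad - W. \<forall>y\<in>V - Bad - W. c x = i \<and> c y = j \<longrightarrow> adj x y)"
      by (rule G.nonadjacent_cover[OF ij q b' b sat, unfolded mis])
    ultimately show ?thesis by (meson order_trans)
  qed
  then obtain W where W: "\<And>i j. i \<noteq> j \<Longrightarrow> W i j \<subseteq> V \<and> real (card (W i j)) \<le> mu \<and>
    (\<forall>x\<in>V - Bad - W i j. \<forall>y\<in>V - Bad - W i j. c x = i \<and> c y = j \<longrightarrow> adj x y)"
    by metis
  define I where "I = {(i, j) \<in> {..<r} \<times> {..<r}. i \<noteq> j}"
  have finI: "finite I" and cI: "card I \<le> r * r"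
  proof -
    have sub: "I \<subseteq> {..<r} \<times> {..<r}" by (auto simp: I_def)
    then show "finite I" by (rule finite_subset) auto
    show "card I \<le> r * r" using card_mono[OF _ sub] by (simp add: card_cartesian_product)
  qed
  define X where "X = (\<Union>p\<in>I. W (fst p) (snd p))"
  define U where "U = V - Bad - X"
  have WI: "W (fst p) (snd p) \<subseteq> V" "real (card (W (fst p) (snd p))) \<le> mu" if "p \<in> I" for p
    using W[of "fst p" "snd p"] that by (auto simp: I_def)
  have XV: "X \<subseteq> V" using WI(1) by (auto simp: X_def)
  \<comment> \<open>\<open>mu\<close> bounds the size of an actual set, whatever the sign of
    \<open>M\<close>.\<close>
  have mu0: "mu \<ge> 0"
    using W[of 0 1] by (meson of_nat_0_le_iff order_trans zero_neq_one)
  have "real (card X) \<le> real (\<Sum>p\<in>I. card (W (fst p) (snd p)))"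
    unfolding X_def by (intro of_nat_mono card_UN_le finI)
  also have "\<dots> = (\<Sum>p\<in>I. real (card (W (fst p) (snd p))))" by simp
  also have "\<dots> \<le> (\<Sum>p\<in>I. mu)" by (intro sum_mono WI(2))
  also have "\<dots> = real (card I) * mu" by simp
  also have "\<dots> \<le> real (r * r) * mu" using cI mu0 by (intro mult_right_mono of_nat_mono)
  finally have cX: "real (card X) \<le> (real r)\<^sup>2 * mu" by (simp add: power2_eq_square)
  have "V \<subseteq> U \<union> (Bad \<union> X)" by (auto simp: U_def)
  then have "card V \<le> card (U \<union> (Bad \<union> X))"
    using finV BadV XV by (intro card_mono) (auto simp: U_def intro: finite_subset)
  then have "card V \<le> card U + (card Bad + card X)"
    using card_Un_le[of U "Bad \<union> X"] card_Un_le[of Bad X] by linarith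
  then have cU: "real n - (B + (real r)\<^sup>2 * mu) \<le> real (card U)"
    using cX cBad g(2) by linarith
  \<comment> \<open>Good vertices of one class are nonadjacent by \<open>indep\<close>; those of
    different classes are adjacent because the covers have been removed.\<close>
  have adjU: "adj x y \<longleftrightarrow> c x \<noteq> c y" if xy: "x \<in> U" "y \<in> U" for x y
  proof
    show "c x \<noteq> c y" if "adj x y" using indep[of x y] that xy by (auto simp: U_def)
    assume ne: "c x \<noteq> c y"
    have "(c x, c y) \<in> I" using xy c ne by (auto simp: I_def U_def)
    then have "W (c x) (c y) \<subseteq> X" by (force simp: X_def)
    then show "adj x y" using W[OF ne] xy unfolding U_def by blast
  qed
  have "induced_edges U E = multipartite_edges c U"
  proof (rule set_eqI)
    fix s
    show "s \<in> induced_edges U E \<longleftrightarrow> s \<in> multipartite_edges c U"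
    proof
      assume "s \<in> induced_edges U E"
      then have s: "s \<in> E" "s \<subseteq> U" by (auto simp: induced_edges_def)
      then obtain x y where "s = {x, y}" using edges by (meson card_2_iff)
      then show "s \<in> multipartite_edges c U"
        using s adjU[of x y] unfolding multipartite_edges_def adj_def by blast
    next
      assume "s \<in> multipartite_edges c U"
      then obtain x y where "s = {x, y}" "x \<in> U" "y \<in> U" "c x \<noteq> c y"
        unfolding multipartite_edges_def by blast
      then show "s \<in> induced_edges U E"
        using adjU[of x y] by (simp add: induced_edges_def adj_def)
    qed
  qed
  then have "complete_multipartite r U (induced_edges U E)"
    unfolding complete_multipartite_def using c by (intro exI[of _ c]) (auto simp: U_def)
  moreover have "U \<subseteq> V" by (auto simp: U_def)
  ultimately show ?thesis using cU unfolding mu_def by blast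
qed

subsection \<open>Asymptotics\<close>

text \<open>With \<open>y\<close> the \<open>r\<close>-th root of \<open>n\<close> and
  \<open>q\<close> about \<open>del * y\<close>, the first cover term is small because
  \<open>m n\<close> is small against \<open>n * y\<close>, the second because it is of order
  \<open>q ^ r\<close>.\<close>

lemma eventually_large_complete_multipartite:
  fixes m :: "nat \<Rightarrow> real" and eps :: real
  assumes r: "r \<ge> 2" and m0: "\<forall>n. m n \<ge> 0"
    and m: "m \<in> o(\<lambda>n. real n powr (real (r + 1) / real r))" and eps: "eps > 0"
  shows "\<forall>\<^sub>F n in sequentially. \<forall>(V :: 'a set) E.
       simple_graph V E \<and> card V = n \<and> saturated (r + 1) V E \<and>
       real (card E) \<ge> real (turan_size r n) - m n \<longrightarrow>
       (\<exists>U\<subseteq>V. complete_multipartite r U (induced_edges U E) \<and>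
          real (card U) \<ge> real n - eps * real n)"
proof -
  define R where "R = real r"
  \<comment> \<open>The total error will be at most
    \<open>(1 + 2 * R\<^sup>2 + 3 * R ^ 3) * (del * n)\<close>, hence the cube. The
    \<open>min 1\<close> makes \<open>3 * R * del\<close> at most 1, so that its powers do not
    exceed it.\<close>
  define del where "del = min 1 eps / (9 * R ^ 3)"
  \<comment> \<open>Chosen so that the bound on \<open>B\<close> becomes
    \<open>del\<^sup>2 * y\<close> and the bound on \<open>16 * m n / q\<close> becomes
    \<open>del * n / R\<^sup>2\<close>.\<close>
  define eta where "eta = del\<^sup>2 / (16 * R\<^sup>2)"
  have R: "R \<ge> 2" using r by (simp add: R_def)
  have R3: "R \<le> R ^ 3" "R\<^sup>2 \<le> R ^ 3" "1 \<le> R ^ 3"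
    using R power_increasing[of 1 3 R] power_increasing[of 2 3 R] one_le_power[of R 3] by auto
  have del0: "del > 0" using eps R by (simp add: del_def)
  have "9 * R ^ 3 * del = min 1 eps" using R by (simp add: del_def)
  then have del: "9 * R ^ 3 * del \<le> 1" "9 * R ^ 3 * del \<le> eps" by auto
  have Rdel: "9 * R * del \<le> 1"
    using mult_right_mono[of "9 * R" "9 * R ^ 3" del] R3(1) del0 del(1) by linarith
  have del1: "9 * del \<le> 1"
    using mult_right_mono[of "9 * 1" "9 * R" del] R Rdel del0 by linarith
  have eta0: "eta > 0" using del0 R by (simp add: eta_def)
  have "\<forall>\<^sub>F n in sequentially. norm (m n) \<le> eta * norm (real n powr (real (r + 1) / real r))"
    by (rule landau_o.smallD[OF m eta0])
  \<comment> \<open>The first bound serves the class size condition \<open>dev\<close>; the second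
    gives \<open>del * y \<ge> 1\<close>.\<close>
  moreover have "\<forall>\<^sub>F n in sequentially. real n \<ge> max (8 * R ^ 3) ((1 / del) ^ r)"
    using filterlim_real_sequentially unfolding filterlim_at_top by blast
  ultimately show ?thesis
  proof eventually_elim
    case (elim n)
    define y where "y = real n powr (1 / R)"
    have n8: "real n \<ge> 8 * R ^ 3" and nd: "real n \<ge> (1 / del) ^ r" using elim(2) by auto
    have n1: "real n \<ge> 1" using n8 R3 by linarith
    then have npos: "n \<ge> 1" by simp
    have y0: "y > 0" using n1 by (simp add: y_def)
    have yr: "y ^ r = real n"
      using n1 r by (simp add: y_def R_def powr_realpow[symmetric] powr_powr)
    have "real n powr (real (r + 1) / real r) = real n powr (1 + 1 / R)"
      using r by (simp add: R_def field_simps)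
    also have "\<dots> = real n * y" using n1 by (simp add: y_def powr_add)
    finally have M: "m n \<le> eta * (real n * y)" "m n \<ge> 0"
      using elim(1) m0 n1 y0 by auto
    have yd: "1 / del \<le> y"
    proof (rule power_le_imp_le_base)
      show "(1 / del) ^ Suc (r - 1) \<le> y ^ Suc (r - 1)" using nd yr r by simp
    qed (use y0 in simp)
    then have dy: "1 \<le> del * y" using del0 by (simp add: field_simps)
    have "1 \<le> y" using yd del0 del1 by (smt (verit) le_divide_eq_1_pos)
    then have yn: "y \<le> real n" using self_le_power[of y r] yr r by simp
    define B where "B = 16 * R\<^sup>2 * m n / real n"
    have "B \<le> 16 * R\<^sup>2 * (eta * (real n * y)) / real n"
      unfolding B_def using M by (intro divide_right_mono mult_left_mono) auto
    also have "\<dots> = del\<^sup>2 * y" using R n1 by (simp add: eta_def)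
    also have "\<dots> \<le> del * y"
      using del0 del1 y0 by (simp add: power2_eq_square mult_le_cancel_right1)
    finally have B: "B \<le> del * y" .
    have B0: "B \<ge> 0" unfolding B_def using M by simp
    have dyn: "del * y \<le> del * real n" using yn del0 by simp
    \<comment> \<open>Rounding up at most doubles the value, since \<open>del * y\<close> is at
      least 1.\<close>
    define q where "q = nat \<lceil>del * y\<rceil>"
    have q: "del * y \<le> real q" "real q \<le> 2 * (del * y)"
      using dy by (auto simp: q_def; linarith)+
    have q1: "q \<ge> 1" using q dy by linarith
    have Bn: "B < real n / (4 * real r)"
    proof -
      have "4 * R * B \<le> 4 * R * (del * real n)" using B dyn R by (intro mult_left_mono) auto
      also have "\<dots> = (4 * R * del) * real n" by simp
      also have "\<dots> < (9 * R * del) * real n" using del0 R n1 by simp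
      also have "\<dots> \<le> 1 * real n" using Rdel n1 by (intro mult_right_mono) auto
      finally show ?thesis using R by (simp add: R_def field_simps)
    qed
    have dev: "real r + 2 * m n \<le> (real n / (2 * real r))\<^sup>2"
    proof -
      have "8 * R\<^sup>2 * R \<le> real n * 1" using n8 by (simp add: power2_eq_square power3_eq_cube)
      also have "\<dots> \<le> real n * real n" using n1 by (intro mult_left_mono) auto
      finally have 1: "8 * R\<^sup>2 * R \<le> (real n)\<^sup>2" by (simp add: power2_eq_square)
      have "8 * R\<^sup>2 * (2 * m n) = B * real n" using n1 by (simp add: B_def)
      also have "\<dots> \<le> real n * real n"
      proof (intro mult_right_mono)
        have "del * real n \<le> 1 * real n" using del1 del0 by (intro mult_right_mono) auto
        then show "B \<le> real n" using B dyn by linarith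
      qed simp
      finally have 2: "8 * R\<^sup>2 * (2 * m n) \<le> (real n)\<^sup>2" by (simp add: power2_eq_square)
      have "8 * R\<^sup>2 * (R + 2 * m n) \<le> 2 * (real n)\<^sup>2" using 1 2 by (simp add: distrib_left)
      then show ?thesis using R by (simp add: R_def field_simps power2_eq_square)
    qed
    have err: "B + R\<^sup>2 * (16 * m n / real q + real q * (B + R * real q) ^ (r - 1)) \<le> eps * real n"
    proof -
      have "16 * m n / real q \<le> 16 * (eta * (real n * y)) / (del * y)"
        using M q dy by (intro frac_le) auto
      also have "\<dots> = del * real n / R\<^sup>2"
        using del0 y0 by (simp add: eta_def field_simps power2_eq_square)
      also have "\<dots> \<le> 2 * (del * real n)"
      proof -
        have "0 \<le> del * real n" using del0 by simp
        moreover from this have "del * real n / R\<^sup>2 \<le> del * real n / 1"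
          using R one_le_power[of R 2] by (intro divide_left_mono) auto
        ultimately show ?thesis by linarith
      qed
      finally have 1: "16 * m n / real q \<le> 2 * (del * real n)" .
      have "R * real q \<le> R * (2 * (del * y))" using q R by (intro mult_left_mono) auto
      moreover have "1 * (del * y) \<le> R * (del * y)" using R dy by (intro mult_right_mono) auto
      ultimately have bb: "B + R * real q \<le> 3 * R * (del * y)" using B by simp
      \<comment> \<open>Bounding the factor \<open>q\<close> by the same base completes an
        \<open>r\<close>-th power, in which \<open>y ^ r = n\<close>.\<close>
      have "real q * (B + R * real q) ^ (r - 1) \<le> (3 * R * (del * y)) * (3 * R * (del * y)) ^ (r - 1)"
      proof (intro mult_mono power_mono bb)
        have "2 * (del * y) \<le> 3 * R * (del * y)" using R dy by (intro mult_right_mono) auto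
        then show "real q \<le> 3 * R * (del * y)" using q by linarith
      qed (use B0 R dy in auto)
      also have "\<dots> = (3 * R * (del * y)) ^ r" using r by (simp add: power_eq_if)
      also have "\<dots> = (3 * R * del) ^ r * real n" by (simp add: power_mult_distrib yr)
      also have "\<dots> \<le> (3 * R * del) ^ 1 * real n"
        using r R del0 Rdel n1 by (intro mult_right_mono power_decreasing) auto
      finally have 2: "real q * (B + R * real q) ^ (r - 1) \<le> 3 * R * (del * real n)" by simp
      have "B + R\<^sup>2 * (16 * m n / real q + real q * (B + R * real q) ^ (r - 1))
          \<le> del * real n + R\<^sup>2 * (2 * (del * real n) + 3 * R * (del * real n))"
        using B dyn 1 2 by (intro add_mono mult_left_mono) auto
      also have "\<dots> = (1 + 2 * R\<^sup>2 + 3 * R ^ 3) * (del * real n)"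
        by (simp add: algebra_simps power2_eq_square power3_eq_cube)
      also have "\<dots> \<le> (9 * R ^ 3) * (del * real n)"
        using R3 del0 n1 by (intro mult_right_mono) auto
      also have "\<dots> = (9 * R ^ 3 * del) * real n" by simp
      also have "\<dots> \<le> eps * real n" using del n1 by (intro mult_right_mono) auto
      finally show ?thesis .
    qed
    show ?case
    proof (intro allI impI, elim conjE)
      fix V :: "'a set" and E
      assume g: "simple_graph V E" "card V = n" "saturated (r + 1) V E"
        "real (card E) \<ge> real (turan_size r n) - m n"
      from large_complete_multipartite[OF r g npos q1 _ Bn dev]
      obtain U where "U \<subseteq> V" "complete_multipartite r U (induced_edges U E)"
        "real n - (B + R\<^sup>2 * (16 * m n / real q + real q * (B + R * real q) ^ (r - 1)))
          \<le> real (card U)" unfolding B_def R_def by blast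
      then show "\<exists>U\<subseteq>V. complete_multipartite r U (induced_edges U E) \<and>
          real (card U) \<ge> real n - eps * real n" using err by (intro exI[of _ U]) auto
    qed
  qed
qed

text \<open>A single \<open>h\<close> has to serve every \<open>eps\<close>. Taking
  \<open>h n\<close> as the least deficit that suffices for all graphs on \<open>n\<close> vertices
  makes it smaller than each bound obtained for a fixed \<open>eps\<close>, up to rounding.\<close>

theorem theorem1:
  fixes r :: nat and m :: "nat \<Rightarrow> real"
  assumes "r \<ge> 2"
    and "\<forall>n. m n \<ge> 0"
    and "m \<in> o(\<lambda>n. real n powr (real (r + 1) / real r))"
  shows "\<exists>h :: nat \<Rightarrow> real. (\<forall>n. h n \<ge> 0) \<and> h \<in> o(\<lambda>n. real n) \<and>
    (\<forall>n (V :: 'a set) E.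
       simple_graph V E \<and> card V = n \<and> saturated (r + 1) V E \<and>
       real (card E) \<ge> real (turan_size r n) - m n \<longrightarrow>
       (\<exists>U\<subseteq>V. complete_multipartite r U (induced_edges U E) \<and>
          real (card U) \<ge> real n - h n))"
proof -
  define good where "good n k \<longleftrightarrow> (\<forall>(V :: 'a set) E.
       simple_graph V E \<and> card V = n \<and> saturated (r + 1) V E \<and>
       real (card E) \<ge> real (turan_size r n) - m n \<longrightarrow>
       (\<exists>U\<subseteq>V. complete_multipartite r U (induced_edges U E) \<and>
          real (card U) \<ge> real n - real k))" for n k :: nat
  define h where "h n = (LEAST k. good n k)" for n
  \<comment> \<open>The empty subgraph is a witness, so the least deficit exists for every
    \<open>n\<close>, also for small ones.\<close>
  have "good n n" for n
    unfolding good_def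
  proof (intro allI impI)
    fix V :: "'a set" and E
    assume "simple_graph V E \<and> card V = n \<and> saturated (r + 1) V E \<and>
       real (card E) \<ge> real (turan_size r n) - m n"
    then have "induced_edges {} E = {}" by (auto simp: induced_edges_def simple_graph_def)
    then have "complete_multipartite r {} (induced_edges {} E)"
      by (simp add: complete_multipartite_def multipartite_edges_def)
    then show "\<exists>U\<subseteq>V. complete_multipartite r U (induced_edges U E) \<and>
       real n - real n \<le> real (card U)" by (intro exI[of _ "{}"]) auto
  qed
  then have good: "good n (h n)" for n unfolding h_def by (rule LeastI)
  have "(\<lambda>n. real (h n)) \<in> o(\<lambda>n. real n)"
  proof (rule landau_o.smallI)
    fix eps :: real assume "eps > 0"
    from eventually_large_complete_multipartite[OF assms this, where 'a = 'a]
    show "\<forall>\<^sub>F n in sequentially. norm (real (h n)) \<le> eps * norm (real n)"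
    proof eventually_elim
      case (elim n)
      have k: "real (nat \<lfloor>eps * real n\<rfloor>) \<le> eps * real n" using \<open>eps > 0\<close> by simp
      have "good n (nat \<lfloor>eps * real n\<rfloor>)"
        unfolding good_def
      proof (intro allI impI)
        fix V :: "'a set" and E
        assume "simple_graph V E \<and> card V = n \<and> saturated (r + 1) V E \<and>
           real (card E) \<ge> real (turan_size r n) - m n"
        then obtain U where U: "U \<subseteq> V" "complete_multipartite r U (induced_edges U E)"
          "real (card U) \<ge> real n - eps * real n" using elim by blast
        \<comment> \<open>As \<open>card U\<close> is an integer, the deficit \<open>eps * n\<close>
          may be rounded down.\<close>
        have "int (card U) \<ge> int n - \<lfloor>eps * real n\<rfloor>" using U(3) by linarith
        then have "real (card U) \<ge> real n - real (nat \<lfloor>eps * real n\<rfloor>)"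
          using \<open>eps > 0\<close> by linarith
        then show "\<exists>U\<subseteq>V. complete_multipartite r U (induced_edges U E) \<and>
           real n - real (nat \<lfloor>eps * real n\<rfloor>) \<le> real (card U)" using U by blast
      qed
      then have "h n \<le> nat \<lfloor>eps * real n\<rfloor>" unfolding h_def by (rule Least_le)
      then show ?case using k by simp
    qed
  qed
  then show ?thesis using good unfolding good_def
    by (intro exI[of _ "\<lambda>n. real (h n)"]) simp
qed

end
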